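(* Let $k\ge1$, let $A\in M_{s,n}(\mathbb{Z})$ be an integer matrix whose entries have greatest common divisor $1$, let $\vec p\in\mathbb{Z}^n$, and let $\mathcal H=\{\vec x\in\mathbb{R}^n: A\vec x=A\vec p\}$. Let $U\in GL_s(\mathbb{Z})$, $V\in GL_n(\mathbb{Z})$ be such that $UAV=D$ is the Smith Normal Form of $A$, let $m=\mathrm{rank}(A)$, and write $V^{-1}\vec p=(p_1',\dots,p_n')$. Then the asymptotic density of $k$-free lattice points on $\mathcal H$ exists and equals \[\prod_{p^k\mid\gcd(p_1',\dots,p_m')}\left(1-\frac{1}{p^{k(n-m)}}\right),\] the product being over primes $p$ with $p^k\mid\gcd(p_1',\dots,p_m')$ (over all primes if this gcd is $0$).
   Context: The Smith Normal Form of $A$ is the $s\times n$ matrix $D$ with zero off-diagonal entries and diagonal entries $d_1\mid d_2\mid\cdots$ with $d_1\cdots d_i$ the gcd of the $i\times i$ minors of $A$ and $d_i=0$ for $i>\mathrm{rank}(A)$. A lattice point $\vec x\in\mathbb{Z}^n$ is $k$-free if there is no prime $p$ with $p^k\mid\gcd(x_1,\dots,x_n)$ (for $k=1$ these are the visible points). For $\Delta\subseteq\mathbb{R}^n$ and $r>0$, let $\Delta_1(r)=\Delta\cap[-r,r]^n\cap\mathbb{Z}^n$ and $\Delta_0^k(r)$ the set of $k$-free points in $\Delta_1(r)$; the asymptotic density of $k$-free lattice points in $\Delta$ is $\lim_{r\to\infty}|\Delta_0^k(r)|/|\Delta_1(r)|$, when the limit exists. *)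

theory Defs
  imports
    Complex_Main
    "HOL-Computational_Algebra.Primes"
    "Jordan_Normal_Form.DL_Rank"
    "Jordan_Normal_Form.DL_Submatrix"
begin

abbreviation real_mat :: "int mat \<Rightarrow> real mat" where
  "real_mat \<equiv> map_mat real_of_int"

abbreviation real_vec :: "int vec \<Rightarrow> real vec" where
  "real_vec \<equiv> map_vec real_of_int"

definition int_rank :: "int mat \<Rightarrow> nat" where
  "int_rank A = vec_space.rank (dim_row A) (real_mat A)"

definition minors :: "nat \<Rightarrow> 'a::comm_ring_1 mat \<Rightarrow> 'a set" where
  "minors i A = {det (submatrix A I J) |I J.
     I \<subseteq> {..<dim_row A} \<and> J \<subseteq> {..<dim_col A} \<and> card I = i \<and> card J = i}"

text \<open>Indices start at 0, so the diagonal entry \<open>d\<^sub>i\<close> of the usual 1-based notation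
  is \<open>D $$ (i - 1, i - 1)\<close>.  Since \<open>Gcd\<close> is nonnegative, the nonzero diagonal entries
  are automatically positive.\<close>

definition is_smith_normal_form :: "int mat \<Rightarrow> int mat \<Rightarrow> bool" where
  "is_smith_normal_form A D \<longleftrightarrow>
     D \<in> carrier_mat (dim_row A) (dim_col A) \<and>
     (\<forall>i<dim_row A. \<forall>j<dim_col A. i \<noteq> j \<longrightarrow> D $$ (i, j) = 0) \<and>
     (\<forall>i. Suc i < min (dim_row A) (dim_col A) \<longrightarrow> D $$ (i, i) dvd D $$ (Suc i, Suc i)) \<and>
     (\<forall>i\<le>min (dim_row A) (dim_col A). (\<Prod>j<i. D $$ (j, j)) = Gcd (minors i A)) \<and>
     (\<forall>i<min (dim_row A) (dim_col A). int_rank A \<le> i \<longrightarrow> D $$ (i, i) = 0)"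

definition k_free :: "nat \<Rightarrow> int vec \<Rightarrow> bool" where
  "k_free k x \<longleftrightarrow>
     \<not> (\<exists>q::nat. prime q \<and> int q ^ k dvd Gcd ((\<lambda>i. x $ i) ` {..<dim_vec x}))"

definition cube :: "nat \<Rightarrow> real \<Rightarrow> real vec set" where
  "cube n r = {x \<in> carrier_vec n. \<forall>i<n. x $ i \<in> {-r..r}}"

definition lattice_points :: "nat \<Rightarrow> real vec set \<Rightarrow> real \<Rightarrow> int vec set" where
  "lattice_points n \<Delta> r = {x \<in> carrier_vec n. real_vec x \<in> \<Delta> \<inter> cube n r}"

definition free_lattice_points :: "nat \<Rightarrow> nat \<Rightarrow> real vec set \<Rightarrow> real \<Rightarrow> int vec set" where
  "free_lattice_points k n \<Delta> r = {x \<in> lattice_points n \<Delta> r. k_free k x}"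

definition has_k_free_density :: "nat \<Rightarrow> nat \<Rightarrow> real vec set \<Rightarrow> real \<Rightarrow> bool" where
  "has_k_free_density k n \<Delta> L \<longleftrightarrow>
     ((\<lambda>r. real (card (free_lattice_points k n \<Delta> r)) / real (card (lattice_points n \<Delta> r)))
        \<longlongrightarrow> L) at_top"

text \<open>The product of \<open>f\<close> over the primes in \<open>S\<close> has value \<open>L\<close>, as a limit of the partial
  products over primes up to \<open>N\<close>.  In contrast to \<open>has_prod\<close>, a limit of 0 is admitted even
  if no factor vanishes, as happens for \<open>1 - 1/q\<close> over all primes.  For finite \<open>S\<close> this
  is the ordinary finite product.\<close>

definition has_prime_product :: "nat set \<Rightarrow> (nat \<Rightarrow> real) \<Rightarrow> real \<Rightarrow> bool" where
  "has_prime_product S f L \<longleftrightarrow>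
     (\<lambda>N. \<Prod>q\<in>{q \<in> S. prime q \<and> q \<le> N}. f q) \<longlonglongrightarrow> L"

end

theory Submission
  imports Defs
begin

text \<open>
  Since \<open>UAV = D\<close> and the first \<open>m\<close> diagonal entries of \<open>D\<close> are exactly the nonzero ones, the
  coordinates \<open>y = W x\<close> of a lattice point \<open>x\<close> on \<open>H\<close> are \<open>(p'\<^sub>1, \<dots>, p'\<^sub>m, t)\<close> with
  \<open>t\<close> an arbitrary integer vector of length \<open>n - m\<close>, and \<open>x\<close> is \<open>k\<close>-free iff no prime \<open>q\<close> with
  \<open>q ^ k\<close> dividing \<open>g\<close> has \<open>q ^ k\<close> dividing \<open>t\<close>.
  Boundary slices of the region of admissible \<open>t\<close> are of lower order, so the points
  divisible by \<open>a\<close> have density \<open>1 / a ^ (n - m)\<close>. Inclusion-exclusion, one prime at a time, gives the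
  density for finitely many primes. When \<open>k (n - m) \<ge> 2\<close> the contribution of the primes above \<open>N\<close> is
  \<open>O(1 / N)\<close>; otherwise, if all primes occur, the product vanishes (by the divergence of the
  harmonic series when \<open>k (n - m) = 1\<close>) and the upper bound suffices.
\<close>

section \<open>Products and sums over primes\<close>

text \<open>Induction on \<open>P\<close>: separating the multiples of a further prime \<open>q\<close>, the new sum \<open>H'\<close> and the
  old one \<open>H\<close> satisfy \<open>H' \<le> H + H' / q\<close>.\<close>

lemma prime_harmonic_bound:
  fixes P :: "nat set" and N :: nat
  assumes "finite P" and "\<And>q. q \<in> P \<Longrightarrow> prime q"
  shows "(\<Prod>q\<in>P. 1 - 1 / real q) * (\<Sum>i | 0 < i \<and> i \<le> N \<and> prime_factors i \<subseteq> P. 1 / real i) \<le> 1"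
  using assms
proof (induction P rule: finite_induct)
  case empty
  have "(\<Sum>i | 0 < i \<and> i \<le> N \<and> prime_factors i \<subseteq> {}. 1 / real i) \<le> (\<Sum>i\<in>{1::nat}. 1 / real i)"
  proof (rule sum_mono2)
    show "{i. 0 < i \<and> i \<le> N \<and> prime_factors i \<subseteq> {}} \<subseteq> {1::nat}"
      by (auto simp: prime_factorization_empty_iff)
  qed auto
  then show ?case by simp
next
  case (insert q P)
  define h where "h Q = {i::nat. 0 < i \<and> i \<le> N \<and> prime_factors i \<subseteq> Q}" for Q
  have fin: "finite (h Q)" for Q
    unfolding h_def by (rule finite_subset[of _ "{..N}"]) auto
  have q: "prime q" "q > 0" using insert.prems by (auto simp: prime_gt_0_nat)
  have sub: "h (insert q P) - h P \<subseteq> (\<lambda>i. q * i) ` h (insert q P)"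
  proof
    fix i assume i: "i \<in> h (insert q P) - h P"
    then have "q dvd i" by (auto simp: h_def)
    then obtain l where l: "i = q * l" by blast
    with i q have "l \<in> h (insert q P)"
      by (auto simp: h_def prime_factors_product intro: order_trans[of l "q * l"])
    with l show "i \<in> (\<lambda>i. q * i) ` h (insert q P)" by blast
  qed
  have "(\<Sum>i\<in>h (insert q P). 1 / real i)
      \<le> (\<Sum>i\<in>h P. 1 / real i) + (\<Sum>i\<in>h (insert q P) - h P. 1 / real i)"
    using fin by (subst sum.subset_diff[of "h P"]) (auto simp: h_def)
  also have "(\<Sum>i\<in>h (insert q P) - h P. 1 / real i) \<le> (\<Sum>i\<in>(\<lambda>i. q * i) ` h (insert q P). 1 / real i)"
    using sub fin by (intro sum_mono2) auto
  also have "\<dots> = (\<Sum>i\<in>h (insert q P). 1 / real q * (1 / real i))"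
    using q by (subst sum.reindex) (auto simp: inj_on_def)
  also have "\<dots> = 1 / real q * (\<Sum>i\<in>h (insert q P). 1 / real i)"
    by (simp add: sum_distrib_left)
  finally have "(1 - 1 / real q) * (\<Sum>i\<in>h (insert q P). 1 / real i) \<le> (\<Sum>i\<in>h P. 1 / real i)"
    by (simp add: algebra_simps)
  moreover have "(\<Prod>q\<in>P. 1 - 1 / real q) \<ge> 0"
  proof (rule prod_nonneg)
    fix q assume "q \<in> P"
    then have "prime q" using insert.prems by auto
    from prime_gt_0_nat[OF this] show "0 \<le> 1 - 1 / real q" by simp
  qed
  ultimately have "(\<Prod>q\<in>P. 1 - 1 / real q) * ((1 - 1 / real q) * (\<Sum>i\<in>h (insert q P). 1 / real i))
      \<le> (\<Prod>q\<in>P. 1 - 1 / real q) * (\<Sum>i\<in>h P. 1 / real i)"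
    by (rule mult_left_mono)
  also have "\<dots> \<le> 1"
    using insert by (simp add: h_def)
  finally show ?case
    using insert.hyps by (simp add: h_def mult_ac)
qed

text \<open>In the induction step the left side grows by \<open>ln (1 + 1 / (N + 1))\<close>, which
  is at most the new summand \<open>1 / (N + 1)\<close>.\<close>

lemma harmonic_ge_ln: "ln (real (Suc N)) \<le> (\<Sum>i=1..N. 1 / real i)"
proof (induction N)
  case (Suc N)
  have 1: "ln (1 + 1 / real (Suc N)) \<le> 1 / real (Suc N)"
    by (rule ln_add_one_self_le_self) (rule divide_nonneg_nonneg, rule zero_le_one, rule of_nat_0_le_iff)
  have "real (Suc (Suc N)) = real (Suc N) * (1 + 1 / real (Suc N))"
    by (simp add: field_simps)
  then have 2: "ln (real (Suc (Suc N))) = ln (real (Suc N)) + ln (1 + 1 / real (Suc N))"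
    by (simp only: ln_mult_pos[of "real (Suc N)" "1 + 1 / real (Suc N)"] add_pos_nonneg of_nat_0_less_iff zero_less_Suc zero_less_one divide_nonneg_nonneg zero_le_one of_nat_0_le_iff)
  have 3: "(\<Sum>i=1..Suc N. 1 / real i) = (\<Sum>i=1..N. 1 / real i) + 1 / real (Suc N)"
    by simp
  show ?case unfolding 2 3 by (rule add_mono[OF Suc.IH 1])
qed simp

text \<open>Every \<open>i\<close> in \<open>{1..N}\<close> has only prime factors up to
  \<open>N\<close>, so \<open>prime_harmonic_bound\<close> applies to the whole harmonic sum and
  bounds the product by \<open>1 / ln (N + 1)\<close>. This settles the borderline exponent 1, where
  the tail of the sieve cannot be summed.\<close>

lemma prime_product_tendsto_0: "(\<lambda>N. \<Prod>q | prime q \<and> q \<le> N. 1 - 1 / real q) \<longlonglongrightarrow> 0"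
proof (rule tendsto_sandwich[OF _ _ tendsto_const])
  show "\<forall>\<^sub>F N in sequentially. 0 \<le> (\<Prod>q | prime q \<and> q \<le> N. 1 - 1 / real q)"
  proof (intro always_eventually allI prod_nonneg)
    fix N q :: nat assume "q \<in> {q. prime q \<and> q \<le> N}"
    then have "q > 0" by (auto simp: prime_gt_0_nat)
    then show "0 \<le> 1 - 1 / real q" by simp
  qed
  show "\<forall>\<^sub>F N in sequentially. (\<Prod>q | prime q \<and> q \<le> N. 1 - 1 / real q) \<le> 1 / ln (real (Suc N))"
    using eventually_gt_at_top[of "0::nat"]
  proof eventually_elim
    case (elim N)
    let ?P = "{q. prime q \<and> q \<le> N}"
    have eq: "{i::nat. 0 < i \<and> i \<le> N \<and> prime_factors i \<subseteq> ?P} = {1..N}"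
      by (auto simp: in_prime_factors_iff intro: order_trans[OF dvd_imp_le])
    have le: "(\<Prod>q\<in>?P. 1 - 1 / real q) * (\<Sum>i=1..N. 1 / real i) \<le> 1"
      unfolding eq[symmetric] by (rule prime_harmonic_bound) auto
    have "(\<Prod>q\<in>?P. 1 - 1 / real q) \<ge> 0"
    proof (rule prod_nonneg)
      fix q assume "q \<in> ?P"
      then have "q > 0" by (auto simp: prime_gt_0_nat)
      then show "0 \<le> 1 - 1 / real q" by simp
    qed
    with mult_left_mono[OF harmonic_ge_ln[of N]] have "(\<Prod>q\<in>?P. 1 - 1 / real q) * ln (real (Suc N)) \<le> 1"
      using le by (meson order_trans)
    moreover have "ln (real (Suc N)) > 0" using elim by simp
    ultimately show ?case by (simp add: field_simps)
  qed
  have "filterlim (\<lambda>N. ln (real (Suc N))) at_top sequentially"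
    by (rule filterlim_compose[OF ln_at_top filterlim_compose[OF filterlim_real_sequentially filterlim_Suc]])
  then show "(\<lambda>N. 1 / ln (real (Suc N))) \<longlonglongrightarrow> 0"
    by (intro tendsto_divide_0[OF tendsto_const] filterlim_at_top_imp_at_infinity)
qed

text \<open>Telescoping: each summand \<open>1 / (M + 1)^2\<close> is at most
  \<open>1 / M - 1 / (M + 1)\<close>.\<close>

lemma sum_inverse_squares_le:
  fixes N M :: nat
  assumes "N > 0"
  shows "(\<Sum>q\<in>{N<..M}. 1 / real q ^ 2) \<le> 1 / real N"
proof (cases "N \<le> M")
  case True
  then have "(\<Sum>q\<in>{N<..M}. 1 / real q ^ 2) \<le> 1 / real N - 1 / real M"
  proof (induction M rule: dec_induct)
    case (step M)
    have "1 / real (Suc M) ^ 2 \<le> 1 / real M - 1 / real (Suc M)"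
    proof -
      have "1 / real M - 1 / real (Suc M) = 1 / (real M * real (Suc M))"
        using assms step.hyps by (simp add: field_simps)
      also have "\<dots> \<ge> 1 / real (Suc M) ^ 2"
        using assms step.hyps by (intro divide_left_mono) (auto simp: power2_eq_square)
      finally show ?thesis .
    qed
    moreover have "{N<..Suc M} = insert (Suc M) {N<..M}" using step.hyps by auto
    ultimately show ?case using step.IH by simp
  qed simp
  then show ?thesis by (smt (verit) divide_nonneg_nonneg of_nat_0_le_iff)
qed simp

section \<open>Counting in an affine lattice\<close>

lemma card_int_box:
  assumes "finite J" and "0 \<le> x"
  shows "real (card (J \<rightarrow>\<^sub>E {-\<lfloor>x\<rfloor>..\<lfloor>x\<rfloor>})) \<le> (2 * x + 1) ^ card J"
proof -
  have "0 \<le> \<lfloor>x\<rfloor>" using assms by simp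
  then have "real (card {-\<lfloor>x\<rfloor>..\<lfloor>x\<rfloor>}) = 2 * of_int \<lfloor>x\<rfloor> + 1" by simp
  also have "\<dots> \<le> 2 * x + 1" by simp
  finally have "real (card {-\<lfloor>x\<rfloor>..\<lfloor>x\<rfloor>}) ^ card J \<le> (2 * x + 1) ^ card J"
    by (intro power_mono) auto
  then show ?thesis using assms by (simp add: card_PiE)
qed

lemma abs_le_floor: "\<bar>real_of_int z\<bar> \<le> x \<Longrightarrow> z \<in> {-\<lfloor>x\<rfloor>..\<lfloor>x\<rfloor>}"
  by (auto simp: le_floor_iff abs_le_iff minus_le_iff)

text \<open>Models the lattice points \<open>x = b + M t\<close> of an affine sublattice; \<open>coord_bound\<close> says that the
  parametrisation is injective with a bounded left inverse.\<close>

locale lattice_slice =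
  fixes I :: "'i set" and J :: "'j set"
    and M :: "'i \<Rightarrow> 'j \<Rightarrow> int" and b :: "'i \<Rightarrow> int" and K :: real
  assumes finite_I: "finite I" and finite_J: "finite J" and K_ge_1: "1 \<le> K"
    and coord_bound: "\<lbrakk>\<And>i. i \<in> I \<Longrightarrow> \<bar>real_of_int (b i + (\<Sum>j\<in>J. M i j * t j))\<bar> \<le> r; j \<in> J\<rbrakk>
      \<Longrightarrow> \<bar>real_of_int (t j)\<bar> \<le> K * r"
begin

section \<open>Boxes of parameters: their size and their boundary\<close>

definition form :: "('j \<Rightarrow> int) \<Rightarrow> 'i \<Rightarrow> int" where
  "form t i = b i + (\<Sum>j\<in>J. M i j * t j)"

text \<open>The bound is on the coordinates of the lattice point, not on its parameters.
  Extensionality outside \<open>J\<close> makes each integer vector a single function, so that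
  cardinalities count vectors.\<close>

definition box :: "real \<Rightarrow> ('j \<Rightarrow> int) set" where
  "box r = {t \<in> J \<rightarrow>\<^sub>E UNIV. \<forall>i\<in>I. \<bar>real_of_int (form t i)\<bar> \<le> r}"

lemma box_coord: "t \<in> box r \<Longrightarrow> j \<in> J \<Longrightarrow> \<bar>real_of_int (t j)\<bar> \<le> K * r"
  using coord_bound[of t r j] by (auto simp: box_def form_def)

lemma box_subset_PiE: "box r \<subseteq> J \<rightarrow>\<^sub>E {-\<lfloor>K * r\<rfloor>..\<lfloor>K * r\<rfloor>}"
proof
  fix t assume t: "t \<in> box r"
  then have "t \<in> extensional J" by (simp add: box_def PiE_def)
  with t show "t \<in> J \<rightarrow>\<^sub>E {-\<lfloor>K * r\<rfloor>..\<lfloor>K * r\<rfloor>}"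
    using abs_le_floor[OF box_coord[OF t]] by (simp add: PiE_def)
qed

lemma finite_box: "finite (box r)"
  by (rule finite_subset[OF box_subset_PiE]) (auto intro: finite_PiE finite_J)

text \<open>The bound does not depend on the position of \<open>t\<close>. It serves twice: for
  comparing with the origin, and for translating between residue classes.\<close>

lemma form_diff_le:
  assumes "\<And>j. j \<in> J \<Longrightarrow> \<bar>t j - u j\<bar> \<le> a"
  shows "\<bar>form t i - form u i\<bar> \<le> a * (\<Sum>j\<in>J. \<bar>M i j\<bar>)"
proof -
  have "form t i - form u i = (\<Sum>j\<in>J. M i j * (t j - u j))"
    by (simp add: form_def algebra_simps sum_subtractf)
  also have "\<bar>\<dots>\<bar> \<le> (\<Sum>j\<in>J. \<bar>M i j\<bar> * a)"
    using assms by (intro order_trans[OF sum_abs] sum_mono) (auto simp: abs_mult intro: mult_left_mono)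
  finally show ?thesis by (simp add: sum_distrib_left mult.commute)
qed

text \<open>One constant that dominates the offset and the row sum of every coordinate at once; the
  leading 1 permits division by it.\<close>

definition coeff_sum where "coeff_sum = 1 + (\<Sum>i\<in>I. \<bar>b i\<bar> + (\<Sum>j\<in>J. \<bar>M i j\<bar>))"

lemma coeff_sum_bound: "i \<in> I \<Longrightarrow> \<bar>b i\<bar> + (\<Sum>j\<in>J. \<bar>M i j\<bar>) \<le> coeff_sum - 1"
  unfolding coeff_sum_def
  using member_le_sum[of i I "\<lambda>i. \<bar>b i\<bar> + (\<Sum>j\<in>J. \<bar>M i j\<bar>)"] finite_I
  by (simp add: sum_nonneg)

lemma coeff_sum_ge_1: "1 \<le> coeff_sum"
  unfolding coeff_sum_def by (simp add: sum_nonneg)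

text \<open>A full cube of parameters with half side \<open>h\<close>, the integer part of
  \<open>r / coeff_sum\<close>, fits into the box, and its side contains \<open>2 * h + 1\<close>
  integers, more than \<open>r / coeff_sum\<close>.\<close>

lemma card_box_ge:
  assumes r: "real_of_int coeff_sum \<le> r"
  shows "(r / coeff_sum) ^ card J \<le> real (card (box r))"
proof -
  define h where "h = \<lfloor>r / coeff_sum\<rfloor>"
  have coeff_sum: "real_of_int coeff_sum \<ge> 1" using coeff_sum_ge_1 by simp
  have h: "h \<ge> 1" unfolding h_def using r coeff_sum by (simp add: le_floor_iff)
  have hr: "of_int (h * coeff_sum) \<le> r"
  proof -
    have "of_int h \<le> r / coeff_sum" unfolding h_def by simp
    then show ?thesis using coeff_sum by (simp add: field_simps)
  qed
  have "J \<rightarrow>\<^sub>E {-h..h} \<subseteq> box r"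
  proof
    fix t assume t: "t \<in> J \<rightarrow>\<^sub>E {-h..h}"
    have "\<bar>real_of_int (form t i)\<bar> \<le> r" if i: "i \<in> I" for i
    proof -
      have "\<bar>form t i - form (\<lambda>_. 0) i\<bar> \<le> h * (\<Sum>j\<in>J. \<bar>M i j\<bar>)"
        using t by (intro form_diff_le) (force simp: PiE_def Pi_def abs_le_iff)
      then have "\<bar>form t i\<bar> \<le> \<bar>b i\<bar> + h * (\<Sum>j\<in>J. \<bar>M i j\<bar>)"
        by (simp add: form_def)
      \<comment> \<open>Since \<open>h\<close> is at least 1, the offset can be scaled by
        \<open>h\<close> too, so that \<open>coeff_sum\<close> dominates offset and row sum
        together.\<close>
      also have "\<bar>b i\<bar> \<le> h * \<bar>b i\<bar>" using mult_right_mono[of 1 h "\<bar>b i\<bar>"] h by simp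
      also have "h * \<bar>b i\<bar> + h * (\<Sum>j\<in>J. \<bar>M i j\<bar>) \<le> h * coeff_sum"
        using coeff_sum_bound[OF i] h unfolding distrib_left[symmetric] by (intro mult_left_mono) auto
      finally have "\<bar>form t i\<bar> \<le> h * coeff_sum" by simp
      then have "of_int \<bar>form t i\<bar> \<le> real_of_int (h * coeff_sum)" by (simp only: of_int_le_iff)
      with hr show ?thesis by simp
    qed
    then show "t \<in> box r" using t by (auto simp: box_def PiE_def)
  qed
  then have "card (J \<rightarrow>\<^sub>E {-h..h}) \<le> card (box r)"
    by (intro card_mono finite_box)
  moreover have "(r / coeff_sum) ^ card J \<le> real (card (J \<rightarrow>\<^sub>E {-h..h}))"
  proof -
    have "r / coeff_sum \<le> 2 * of_int h + 1" using h unfolding h_def by linarith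
    moreover have "real (card {-h..h}) = 2 * of_int h + 1" using h by simp
    moreover have "0 \<le> r / coeff_sum" using r coeff_sum by simp
    ultimately have "(r / coeff_sum) ^ card J \<le> real (card {-h..h}) ^ card J"
      by (intro power_mono) auto
    then show ?thesis by (simp add: card_PiE finite_J)
  qed
  ultimately show ?thesis by linarith
qed

text \<open>As \<open>M i j\<close> is nonzero, the equation determines \<open>t j\<close> from the
  other parameters. Forgetting \<open>t j\<close> is therefore injective on the slice, with image in
  a cube of one dimension less.\<close>

lemma card_slice_le:
  assumes "j \<in> J" and "M i j \<noteq> 0" and "r \<ge> 1"
  shows "real (card {t \<in> box r. form t i = v}) \<le> (3 * K * r) ^ (card J - 1)"
proof -
  let ?S = "{t \<in> box r. form t i = v}"
  let ?T = "(J - {j}) \<rightarrow>\<^sub>E {-\<lfloor>K * r\<rfloor>..\<lfloor>K * r\<rfloor>}"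
  have Kr: "K * r \<ge> 1" using K_ge_1 assms mult_mono[of 1 K 1 r] by simp
  have "inj_on (\<lambda>t. restrict t (J - {j})) ?S"
  proof (rule inj_onI)
    fix t u assume t: "t \<in> ?S" and u: "u \<in> ?S"
      and eq: "restrict t (J - {j}) = restrict u (J - {j})"
    have *: "t l = u l" if "l \<in> J - {j}" for l
      using fun_cong[OF eq, of l] that by simp
    then have "(\<Sum>l\<in>J - {j}. M i l * t l) = (\<Sum>l\<in>J - {j}. M i l * u l)" by simp
    moreover have "form t i = form u i" using t u by simp
    ultimately have "M i j * t j = M i j * u j"
      using assms(1) by (simp add: form_def sum.remove[OF finite_J])
    then have "t j = u j" using assms by simp
    with * have "\<forall>l\<in>J. t l = u l" by blast
    moreover have "t \<in> extensional J" "u \<in> extensional J" using t u by (auto simp: box_def PiE_def)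
    ultimately show "t = u" by (meson extensionalityI)
  qed
  moreover have "(\<lambda>t. restrict t (J - {j})) ` ?S \<subseteq> ?T"
  proof clarify
    fix t assume "t \<in> box r"
    then have "t \<in> J \<rightarrow>\<^sub>E {-\<lfloor>K * r\<rfloor>..\<lfloor>K * r\<rfloor>}" using box_subset_PiE by blast
    then show "restrict t (J - {j}) \<in> ?T" by (auto simp: PiE_def Pi_def)
  qed
  moreover have "finite ?T" by (auto intro: finite_PiE finite_J)
  ultimately have "card ?S \<le> card ?T" by (meson card_inj_on_le)
  also have "real (card ?T) \<le> (2 * (K * r) + 1) ^ card (J - {j})"
    using Kr finite_J by (intro card_int_box) auto
  also have "\<dots> \<le> (3 * K * r) ^ card (J - {j})"
    using Kr by (intro power_mono) auto
  also have "card (J - {j}) = card J - 1" using assms by (simp add: finite_J)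
  finally show ?thesis by simp
qed

text \<open>A point of the shell has a coordinate \<open>form t i\<close> with one of at most \<open>2c\<close> values. If this form
  is not constant, each value cuts out a slice of one dimension less.\<close>

lemma card_shell_le:
  fixes c :: nat and r :: real
  assumes r: "r \<ge> coeff_sum" "r \<ge> c"
  shows "real (card (box (r + c) - box r)) * r \<le> real (card I) * (2 * c) * (6 * K * r) ^ card J"
proof -
  \<comment> \<open>The integers of absolute value above \<open>r\<close> and at most
    \<open>r + c\<close>.\<close>
  define Z where "Z = {\<lfloor>r\<rfloor> + 1..\<lfloor>r\<rfloor> + int c} \<union> uminus ` {\<lfloor>r\<rfloor> + 1..\<lfloor>r\<rfloor> + int c}"
  define I' where "I' = {i \<in> I. \<exists>j\<in>J. M i j \<noteq> 0}"
  have r1: "r \<ge> 1" using r coeff_sum_ge_1 by linarith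
  have Z: "finite Z" "card Z \<le> 2 * c"
    unfolding Z_def by (auto intro: order_trans[OF card_Un_le] simp: card_image)
  have I': "finite I'" "card I' \<le> card I"
    unfolding I'_def by (auto intro!: card_mono finite_I finite_subset[OF _ finite_I])
  have sub: "box (r + c) - box r \<subseteq> (\<Union>(i, v)\<in>I' \<times> Z. {t \<in> box (r + c). form t i = v})"
  proof
    fix t assume t: "t \<in> box (r + c) - box r"
    then obtain i where i: "i \<in> I" "\<bar>real_of_int (form t i)\<bar> > r" by (force simp: box_def)
    have le: "\<bar>real_of_int (form t i)\<bar> \<le> r + c" using t i by (auto simp: box_def)
    \<comment> \<open>A constant form equals its offset, which \<open>coeff_sum\<close> and hence
      \<open>r\<close> dominates, so it cannot leave the box.\<close>
    have "\<exists>j\<in>J. M i j \<noteq> 0"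
    proof (rule ccontr)
      assume "\<not> (\<exists>j\<in>J. M i j \<noteq> 0)"
      then have "form t i = b i" by (simp add: form_def)
      moreover have "\<bar>b i\<bar> \<le> coeff_sum" using coeff_sum_bound[OF i(1)] sum_nonneg[of J "\<lambda>j. \<bar>M i j\<bar>"] by linarith
      ultimately show False using i r by linarith
    qed
    then have "i \<in> I'" using i by (simp add: I'_def)
    moreover have "form t i \<in> Z"
    proof (cases "form t i \<ge> 0")
      case True
      then have "form t i - int c \<le> \<lfloor>r\<rfloor>" "\<lfloor>r\<rfloor> < form t i"
        using i le by (simp_all add: le_floor_iff floor_less_iff)
      then have "form t i \<in> {\<lfloor>r\<rfloor> + 1..\<lfloor>r\<rfloor> + int c}" by simp
      then show ?thesis by (simp add: Z_def)
    next
      case False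
      then have "- form t i - int c \<le> \<lfloor>r\<rfloor>" "\<lfloor>r\<rfloor> < - form t i"
        using i le by (simp_all add: le_floor_iff floor_less_iff)
      then have "- form t i \<in> {\<lfloor>r\<rfloor> + 1..\<lfloor>r\<rfloor> + int c}" by simp
      then show ?thesis unfolding Z_def by (metis UnI2 image_eqI minus_minus)
    qed
    ultimately show "t \<in> (\<Union>(i, v)\<in>I' \<times> Z. {t \<in> box (r + c). form t i = v})" using t by blast
  qed
  show ?thesis
  proof (cases "I' = {}")
    case True
    then have empty: "box (r + c) - box r = {}" using sub by auto
    show ?thesis unfolding empty using r1 K_ge_1 by simp
  next
    case False
    \<comment> \<open>A nonzero coefficient has an index in \<open>J\<close>, so
      \<open>card J - 1\<close> is a true predecessor and one power of \<open>r\<close> is really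
      gained.\<close>
    then have "J \<noteq> {}" by (auto simp: I'_def)
    then have d: "card J = Suc (card J - 1)" using finite_J by (simp add: card_gt_0_iff)
    have "card (box (r + c) - box r) \<le> card (\<Union>(i, v)\<in>I' \<times> Z. {t \<in> box (r + c). form t i = v})"
      using Z I' by (intro card_mono[OF _ sub]) (auto intro: finite_subset[OF _ finite_box])
    also have "\<dots> \<le> (\<Sum>(i, v)\<in>I' \<times> Z. card {t \<in> box (r + c). form t i = v})"
      using Z I' card_UN_le[of "I' \<times> Z" "\<lambda>(i, v). {t \<in> box (r + c). form t i = v}"]
      by (simp add: case_prod_unfold)
    finally have "real (card (box (r + c) - box r))
        \<le> (\<Sum>(i, v)\<in>I' \<times> Z. real (card {t \<in> box (r + c). form t i = v}))"
      by (simp add: case_prod_unfold flip: of_nat_sum)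
    also have "\<dots> \<le> (\<Sum>(i, v)\<in>I' \<times> Z. (6 * K * r) ^ (card J - 1))"
    proof (intro sum_mono, clarify)
      fix i v assume "i \<in> I'"
      then obtain j where j: "j \<in> J" "M i j \<noteq> 0" by (auto simp: I'_def)
      have "real (card {t \<in> box (r + c). form t i = v}) \<le> (3 * K * (r + c)) ^ (card J - 1)"
        using r1 by (intro card_slice_le[OF j]) auto
      \<comment> \<open>Here \<open>r + c\<close> is at most \<open>2 * r\<close>, which doubles the
        constant 3.\<close>
      also have "\<dots> \<le> (6 * K * r) ^ (card J - 1)"
        using r r1 K_ge_1 by (intro power_mono) (auto simp: field_simps)
      finally show "real (card {t \<in> box (r + c). form t i = v}) \<le> (6 * K * r) ^ (card J - 1)" .
    qed
    also have "\<dots> = real (card I') * real (card Z) * (6 * K * r) ^ (card J - 1)"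
      by (simp add: card_cartesian_product)
    also have "\<dots> \<le> real (card I) * (2 * c) * (6 * K * r) ^ (card J - 1)"
    proof -
      have "real (card Z) \<le> 2 * c" using Z(2) by linarith
      then show ?thesis using I' r1 K_ge_1 by (intro mult_right_mono mult_mono) auto
    qed
    finally have "real (card (box (r + c) - box r)) * r
        \<le> real (card I) * (2 * c) * (6 * K * r) ^ (card J - 1) * r"
      using r1 by (intro mult_right_mono) auto
    also have "\<dots> \<le> real (card I) * (2 * c) * (6 * K * r) ^ (card J - 1) * (6 * K * r)"
      using r1 K_ge_1 mult_right_mono[of 1 K r] by (intro mult_left_mono) auto
    also have "\<dots> = real (card I) * (2 * c) * (6 * K * r) ^ card J"
      using d by (metis mult.assoc mult.commute power_Suc)
    finally show ?thesis .
  qed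
qed

text \<open>The shell has order at most \<open>r ^ (card J - 1)\<close>, while the box has order at
  least \<open>r ^ card J\<close>; the quotient is at most \<open>L / r\<close>.\<close>

lemma shell_density_0:
  fixes c :: nat
  shows "((\<lambda>r::real. real (card (box (r + c) - box r)) / real (card (box r))) \<longlongrightarrow> 0) at_top"
proof (rule tendsto_sandwich[OF _ _ tendsto_const])
  define L where "L = real (card I) * (2 * c) * (6 * K * coeff_sum) ^ card J"
  have C1: "real_of_int coeff_sum \<ge> 1" using coeff_sum_ge_1 by simp
  show "\<forall>\<^sub>F r::real in at_top. real (card (box (r + c) - box r)) / real (card (box r)) \<le> L / r"
    using eventually_ge_at_top[of "real_of_int coeff_sum"] eventually_ge_at_top[of "real c"]
  proof eventually_elim
    case (elim r)
    have r: "r \<ge> 1" using elim C1 by linarith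
    have pos: "real (card (box r)) > 0"
      using card_box_ge[OF elim(1)] r C1 by (intro less_le_trans[OF _ card_box_ge[OF elim(1)]]) auto
    have "real (card (box (r + c) - box r)) * r \<le> real (card I) * (2 * c) * (6 * K * r) ^ card J"
      by (rule card_shell_le[OF elim])
    also have "6 * K * r = 6 * K * coeff_sum * (r / coeff_sum)" using C1 by simp
    also have "\<dots> ^ card J = (6 * K * coeff_sum) ^ card J * (r / coeff_sum) ^ card J" by (rule power_mult_distrib)
    also have "real (card I) * (2 * c) * \<dots> \<le> L * real (card (box r))"
      using card_box_ge[OF elim(1)] K_ge_1 C1 unfolding L_def
      by (simp only: mult.assoc[symmetric]) (intro mult_left_mono, auto)
    finally show ?case using pos r by (simp add: field_simps)
  qed
  show "((\<lambda>r. L / r) \<longlongrightarrow> 0) at_top"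
    by (intro tendsto_divide_0[OF tendsto_const] filterlim_at_top_imp_at_infinity filterlim_ident)
qed auto

section \<open>Residue classes and the sieve by finitely many primes\<close>

lemma box_pos:
  assumes "real_of_int coeff_sum \<le> r"
  shows "card (box r) > 0"
proof -
  have "0 < (r / coeff_sum) ^ card J" using assms coeff_sum_ge_1 by (intro zero_less_power divide_pos_pos) linarith+
  then show ?thesis using card_box_ge[OF assms] by linarith
qed

text \<open>Translations between residue classes modulo \<open>a\<close> move points only by a bounded amount, so up to
  the shell all \<open>a ^ card J\<close> classes contain equally many points of the box.\<close>

lemma multiples_density:
  assumes "a > 0"
  shows "((\<lambda>r. real (card {t \<in> box r. \<forall>j\<in>J. int a dvd t j}) / real (card (box r)))
    \<longlongrightarrow> 1 / real a ^ card J) at_top"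
proof -
  \<comment> \<open>A translation between residues changes each parameter by at most
    \<open>a\<close>, hence each coordinate by at most \<open>a\<close> times a row sum, which
    \<open>c\<close> dominates.\<close>
  define c where "c = a * nat coeff_sum"
  define R where "R = J \<rightarrow>\<^sub>E {0..<int a}"
  define cls where "cls e r = {t \<in> box r. \<forall>j\<in>J. t j mod int a = e j}" for e r
  define shell where "shell r = box (r + c) - box r" for r :: real
  have fin: "finite (cls e r)" "finite (shell r)" "finite R" for e r
    unfolding cls_def shell_def R_def using finite_box finite_J by (auto intro: finite_PiE)
  have cR: "card R = a ^ card J" unfolding R_def using finite_J by (simp add: card_PiE)
  have shift: "card (cls e r) \<le> card (cls e' r) + card (shell r)" if e: "e \<in> R" and e': "e' \<in> R" for e e' r
  proof -
    \<comment> \<open>Exchanges the residue \<open>e\<close> for \<open>e'\<close> and keeps the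
      quotients modulo \<open>a\<close>; the image may leave the box, but only into the
      shell.\<close>
    define f where "f t = (\<lambda>j\<in>J. t j - e j + e' j)" for t
    have "inj_on f (cls e r)"
    proof (rule inj_onI)
      fix t u assume t: "t \<in> cls e r" and u: "u \<in> cls e r" and eq: "f t = f u"
      have "t j = u j" if "j \<in> J" for j
        using fun_cong[OF eq, of j] that by (simp add: f_def)
      moreover have "t \<in> extensional J" "u \<in> extensional J"
        using t u by (auto simp: cls_def box_def PiE_def)
      ultimately show "t = u" by (meson extensionalityI)
    qed
    moreover have "f ` cls e r \<subseteq> cls e' r \<union> shell r"
    proof clarify
      fix t assume t: "t \<in> cls e r" and ns: "f t \<notin> shell r"
      have "\<bar>real_of_int (form (f t) i)\<bar> \<le> r + c" if i: "i \<in> I" for i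
      proof -
        have "\<bar>form (f t) i - form t i\<bar> \<le> int a * (\<Sum>j\<in>J. \<bar>M i j\<bar>)"
        proof (rule form_diff_le)
          fix j assume j: "j \<in> J"
          then have "e j \<in> {0..<int a}" "e' j \<in> {0..<int a}" using e e' by (auto simp: R_def)
          with j show "\<bar>f t j - t j\<bar> \<le> int a" by (simp add: f_def abs_le_iff)
        qed
        also have "\<dots> \<le> int a * coeff_sum"
          using coeff_sum_bound[OF i] by (intro mult_left_mono) auto
        also have "\<dots> = int c" using coeff_sum_ge_1 by (simp add: c_def)
        finally have "\<bar>form (f t) i - form t i\<bar> \<le> int c" .
        moreover have "\<bar>real_of_int (form t i)\<bar> \<le> r" using t i by (simp add: cls_def box_def)
        ultimately show ?thesis by linarith
      qed
      then have "f t \<in> box (r + c)" by (auto simp: box_def f_def)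
      with ns have "f t \<in> box r" by (simp add: shell_def)
      moreover have "f t j mod int a = e' j" if j: "j \<in> J" for j
      proof -
        have "t j mod int a = e j" using t j by (simp add: cls_def)
        then have "f t j = (t j - t j mod int a) + e' j" using j by (simp add: f_def)
        also have "\<dots> mod int a = e' j mod int a"
          by (metis add.commute minus_mod_eq_mult_div mod_mult_self2)
        also have "\<dots> = e' j" using PiE_mem[OF e'[unfolded R_def] j] by simp
        finally show ?thesis .
      qed
      ultimately show "f t \<in> cls e' r" by (simp add: cls_def)
    qed
    ultimately have "card (cls e r) \<le> card (cls e' r \<union> shell r)"
      using fin by (meson card_inj_on_le finite_UnI)
    also have "\<dots> \<le> card (cls e' r) + card (shell r)" by (rule card_Un_le)
    finally show ?thesis .
  qed
  define z where "z = (\<lambda>j\<in>J. 0 :: int)"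
  have z: "z \<in> R" using assms by (simp add: z_def R_def)
  have clsz: "cls z r = {t \<in> box r. \<forall>j\<in>J. int a dvd t j}" for r
    by (auto simp: cls_def z_def dvd_eq_mod_eq_0)
  have part: "card (box r) = (\<Sum>e\<in>R. card (cls e r))" for r
  proof -
    have "box r = (\<Union>e\<in>R. cls e r)"
    proof (intro equalityI subsetI)
      fix t assume "t \<in> box r"
      then have "t \<in> cls (\<lambda>j\<in>J. t j mod int a) r" by (simp add: cls_def)
      moreover have "(\<lambda>j\<in>J. t j mod int a) \<in> R" using assms by (simp add: R_def)
      ultimately show "t \<in> (\<Union>e\<in>R. cls e r)" by blast
    qed (auto simp: cls_def)
    moreover have "cls e r \<inter> cls e' r = {}" if "e \<in> R" "e' \<in> R" "e \<noteq> e'" for e e'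
    proof -
      have "\<exists>j\<in>J. e j \<noteq> e' j"
      proof (rule ccontr)
        assume "\<not> (\<exists>j\<in>J. e j \<noteq> e' j)"
        then have "e = e'" using that(1,2) unfolding R_def by (intro PiE_ext) auto
        with that(3) show False by simp
      qed
      then show ?thesis by (auto simp: cls_def)
    qed
    ultimately show ?thesis using card_UN_disjoint[of R "\<lambda>e. cls e r"] fin by simp
  qed
  \<comment> \<open>Each of the \<open>a ^ card J\<close> classes is compared with the zero class,
    at the cost of one shell.\<close>
  have bound: "\<bar>real (card (box r)) - real (a ^ card J) * real (card (cls z r))\<bar>
      \<le> real (a ^ card J) * real (card (shell r))" for r
  proof -
    have "real (card (box r)) - real (a ^ card J) * real (card (cls z r))
        = (\<Sum>e\<in>R. real (card (cls e r)) - real (card (cls z r)))"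
      by (simp add: part sum_subtractf cR)
    also have "\<bar>\<dots>\<bar> \<le> (\<Sum>e\<in>R. real (card (shell r)))"
    proof (rule order_trans[OF sum_abs sum_mono])
      fix e assume "e \<in> R"
      from shift[OF this z, of r] shift[OF z this, of r]
      show "\<bar>real (card (cls e r)) - real (card (cls z r))\<bar> \<le> real (card (shell r))" by linarith
    qed
    finally show ?thesis by (simp add: cR)
  qed
  have "((\<lambda>r. real (card (cls z r)) / real (card (box r)) - 1 / real a ^ card J) \<longlongrightarrow> 0) at_top"
  proof (rule tendsto_0_le[where K = 1])
    show "((\<lambda>r. real (card (shell r)) / real (card (box r))) \<longlongrightarrow> 0) at_top"
      unfolding shell_def by (rule shell_density_0)
    show "\<forall>\<^sub>F r in at_top. norm (real (card (cls z r)) / real (card (box r)) - 1 / real a ^ card J)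
        \<le> norm (real (card (shell r)) / real (card (box r))) * 1"
      using eventually_ge_at_top[of "real_of_int coeff_sum"]
    proof eventually_elim
      case (elim r)
      define A where "A = real (a ^ card J)"
      define B where "B = real (card (box r))"
      define X where "X = real (card (cls z r))"
      define E where "E = real (card (shell r))"
      have pos: "A > 0" "B > 0" using assms box_pos[OF elim] by (simp_all add: A_def B_def)
      have "\<bar>B - A * X\<bar> \<le> A * E" using bound[of r] by (simp add: A_def B_def X_def E_def)
      then have "\<bar>B - A * X\<bar> / (A * B) \<le> (A * E) / (A * B)"
        using pos by (intro divide_right_mono) auto
      moreover have "X / B - 1 / A = - ((B - A * X) / (A * B))" using pos by (simp add: field_simps)
      then have "\<bar>X / B - 1 / A\<bar> = \<bar>B - A * X\<bar> / (A * B)" using pos by (simp add: abs_mult)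
      ultimately have "\<bar>X / B - 1 / A\<bar> \<le> E / B" using pos by simp
      then show ?case by (simp add: A_def B_def X_def E_def)
    qed
  qed
  then show ?thesis unfolding clsz by (rule LIM_zero_cancel)
qed

text \<open>The modulus \<open>a\<close> is carried along to make the induction work: sieving by a
  further \<open>q\<close> subtracts, from the count for \<open>a\<close>, the count for
  \<open>a * q ^ k\<close>, and both are instances of the hypothesis for the smaller set.\<close>

lemma sieve_density:
  assumes "finite F" and "\<And>q. q \<in> F \<Longrightarrow> prime q" and "a > 0" and "\<And>q. q \<in> F \<Longrightarrow> coprime a q"
  shows "((\<lambda>r. real (card {t \<in> box r. (\<forall>j\<in>J. int a dvd t j) \<and> (\<forall>q\<in>F. \<not> (\<forall>j\<in>J. int q ^ k dvd t j))})
      / real (card (box r)))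
    \<longlongrightarrow> 1 / real a ^ card J * (\<Prod>q\<in>F. 1 - 1 / real q ^ (k * card J))) at_top"
  using assms
proof (induction F arbitrary: a rule: finite_induct)
  case empty
  then show ?case using multiples_density[of a] by simp
next
  case (insert q F)
  define S where "S F a r = {t \<in> box r. (\<forall>j\<in>J. int a dvd t j) \<and> (\<forall>q\<in>F. \<not> (\<forall>j\<in>J. int q ^ k dvd t j))}"
    for F :: "nat set" and a :: nat and r
  have q: "prime q" "coprime a q" "q > 0" using insert.prems by (auto simp: prime_gt_0_nat)
  \<comment> \<open>Coprimality merges the conditions for \<open>a\<close> and \<open>q ^ k\<close>
    into divisibility by the product.\<close>
  have "coprime (int a) (int q ^ k)" using q by simp
  then have dvd: "int (a * q ^ k) dvd x \<longleftrightarrow> int a dvd x \<and> int q ^ k dvd x" for x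
    by (auto intro: divides_mult dest: dvd_mult_left dvd_mult_right)
  have eq: "S (insert q F) a r = S F a r - S F (a * q ^ k) r" for r
    unfolding S_def dvd by blast
  have sub: "S F (a * q ^ k) r \<subseteq> S F a r" for r
    unfolding S_def dvd by blast
  have fin: "finite (S F' a' r)" for F' a' r
    unfolding S_def using finite_box by simp
  have card: "real (card (S (insert q F) a r)) = real (card (S F a r)) - real (card (S F (a * q ^ k) r))" for r
    using card_Diff_subset[OF fin sub] card_mono[OF fin sub] by (simp add: eq of_nat_diff)
  let ?P = "\<Prod>q\<in>F. 1 - 1 / real q ^ (k * card J)"
  have 1: "((\<lambda>r. real (card (S F a r)) / real (card (box r))) \<longlongrightarrow> 1 / real a ^ card J * ?P) at_top"
    unfolding S_def using insert.prems by (intro insert.IH) auto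
  have 2: "((\<lambda>r. real (card (S F (a * q ^ k) r)) / real (card (box r)))
      \<longlongrightarrow> 1 / real (a * q ^ k) ^ card J * ?P) at_top"
    unfolding S_def
  proof (rule insert.IH)
    fix p assume p: "p \<in> F"
    then have "prime p" "coprime a p" "p \<noteq> q" using insert by auto
    then show "coprime (a * q ^ k) p"
      using q by (auto simp: primes_coprime)
  qed (use insert.prems q in auto)
  have "1 / real a ^ card J * ?P - 1 / real (a * q ^ k) ^ card J * ?P
      = 1 / real a ^ card J * (\<Prod>q\<in>insert q F. 1 - 1 / real q ^ (k * card J))"
    using insert.hyps q by (simp add: power_mult power_mult_distrib right_diff_distrib left_diff_distrib mult_ac)
  with tendsto_diff[OF 1 2] show ?case
    unfolding S_def[symmetric] card diff_divide_distrib by simp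
qed

section \<open>Large primes and the full sieve\<close>

text \<open>The summand 1 is the point \<open>t = 0\<close>, which every \<open>q ^ k\<close> divides.\<close>

lemma tail_le:
  assumes kd: "2 \<le> k * card J" and N: "N > 0" and r: "r \<ge> 1"
  shows "real (card {t \<in> box r. \<exists>q>N. prime q \<and> (\<forall>j\<in>J. int q ^ k dvd t j)})
    \<le> 1 + (3 * K * r) ^ card J / real N"
proof -
  define m where "m = nat \<lfloor>K * r\<rfloor>"
  \<comment> \<open>A nonzero parameter divisible by \<open>q ^ k\<close> has absolute value at
    least \<open>q ^ k\<close> and at most \<open>K * r\<close>, so only these \<open>q\<close> can
    divide a nonzero point.\<close>
  define Q where "Q = {q \<in> {N<..m}. real q ^ k \<le> K * r}"
  define D where "D q = {t \<in> box r. \<forall>j\<in>J. int q ^ k dvd t j}" for q :: nat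
  define z where "z = (\<lambda>j\<in>J. 0 :: int)"
  have k: "k \<ge> 1" using kd by (cases k) auto
  have Kr: "K * r \<ge> 1" using K_ge_1 r mult_mono[of 1 K 1 r] by simp
  have finQ: "finite Q" by (simp add: Q_def)
  have sub: "{t \<in> box r. \<exists>q>N. prime q \<and> (\<forall>j\<in>J. int q ^ k dvd t j)} \<subseteq> insert z (\<Union>q\<in>Q. D q)"
  proof clarify
    fix t q assume t: "t \<in> box r" and q: "N < q" "prime q" and dvd: "\<forall>j\<in>J. int q ^ k dvd t j"
      and notin: "t \<notin> (\<Union>q\<in>Q. D q)"
    have "t j = 0" if j: "j \<in> J" for j
    proof (rule ccontr)
      assume "t j \<noteq> 0"
      then have "int q ^ k \<le> \<bar>t j\<bar>" using dvd j by (metis abs_ge_self dvd_imp_le_int order_trans)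
      then have "real q ^ k \<le> real_of_int \<bar>t j\<bar>"
        by (metis of_int_le_iff of_int_of_nat_eq of_int_power)
      also have "\<dots> \<le> K * r" using box_coord[OF t j] by simp
      finally have qk: "real q ^ k \<le> K * r" .
      have le: "real q \<le> real q ^ k" using power_increasing[of 1 k "real q"] k q by simp
      from order_trans[OF le qk] have "q \<le> m" unfolding m_def by (simp add: le_nat_floor)
      with qk q have "q \<in> Q" by (simp add: Q_def)
      moreover have "t \<in> D q" using t dvd by (simp add: D_def)
      ultimately show False using notin by blast
    qed
    moreover have "t \<in> extensional J" using t by (auto simp: box_def PiE_def)
    ultimately show "t = z" by (intro extensionalityI[of _ J]) (auto simp: z_def)
  qed
  \<comment> \<open>Division by \<open>q ^ k\<close> maps the points into a cube of half side
    \<open>?y\<close>. Membership in \<open>Q\<close> means that \<open>?y\<close> is at least 1,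
    whence \<open>2 * ?y + 1\<close> is at most \<open>3 * ?y\<close>.\<close>
  have D: "real (card (D q)) \<le> (3 * K * r) ^ card J * (1 / real q ^ 2)" if "q \<in> Q" for q
  proof -
    let ?y = "K * r / real q ^ k"
    let ?T = "J \<rightarrow>\<^sub>E {-\<lfloor>?y\<rfloor>..\<lfloor>?y\<rfloor>}"
    have q: "q \<ge> 1" "real q ^ k > 0" and y: "?y \<ge> 1" using that N by (auto simp: Q_def)
    have "D q \<subseteq> (\<lambda>u. \<lambda>j\<in>J. int q ^ k * u j) ` ?T"
    proof
      fix t assume t: "t \<in> D q"
      let ?u = "\<lambda>j\<in>J. t j div int q ^ k"
      have "?u j \<in> {-\<lfloor>?y\<rfloor>..\<lfloor>?y\<rfloor>}" if j: "j \<in> J" for j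
      proof (rule abs_le_floor)
        have "real_of_int (?u j) = real_of_int (t j) / real q ^ k"
          using t j by (simp add: D_def real_of_int_div)
        moreover have "\<bar>real_of_int (t j)\<bar> \<le> K * r" using t j box_coord by (simp add: D_def)
        ultimately show "\<bar>real_of_int (?u j)\<bar> \<le> ?y" using q by (simp add: divide_right_mono)
      qed
      then have "?u \<in> ?T" by auto
      moreover have "t = (\<lambda>j\<in>J. int q ^ k * ?u j)"
        using t by (intro extensionalityI[of _ J]) (auto simp: D_def box_def PiE_def)
      ultimately show "t \<in> (\<lambda>u. \<lambda>j\<in>J. int q ^ k * u j) ` ?T" by blast
    qed
    then have "card (D q) \<le> card ?T"
      by (rule surj_card_le[rotated]) (auto intro: finite_PiE finite_J)
    also have "real (card ?T) \<le> (2 * ?y + 1) ^ card J"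
      using y finite_J by (intro card_int_box) auto
    also have "\<dots> \<le> (3 * ?y) ^ card J" using y by (intro power_mono) auto
    also have "\<dots> = (3 * K * r) ^ card J * (1 / real q ^ (k * card J))"
      by (simp add: power_divide power_mult power_mult_distrib)
    \<comment> \<open>The assumption \<open>kd\<close> enters here: the exponent
      \<open>k * card J\<close> is large enough for a summable bound.\<close>
    also have "\<dots> \<le> (3 * K * r) ^ card J * (1 / real q ^ 2)"
    proof (intro mult_left_mono divide_left_mono)
      show "real q ^ 2 \<le> real q ^ (k * card J)" using kd q by (intro power_increasing) auto
    qed (use q Kr in auto)
    finally show ?thesis by simp
  qed
  have finD: "finite (D q)" for q unfolding D_def using finite_box by simp
  have "card {t \<in> box r. \<exists>q>N. prime q \<and> (\<forall>j\<in>J. int q ^ k dvd t j)} \<le> card (insert z (\<Union>q\<in>Q. D q))"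
    using finD finQ by (intro card_mono[OF _ sub]) auto
  also have "\<dots> \<le> Suc (card (\<Union>q\<in>Q. D q))" using finD finQ by (simp add: card_insert_if)
  also have "\<dots> \<le> Suc (\<Sum>q\<in>Q. card (D q))" using card_UN_le[OF finQ] by simp
  finally have "real (card {t \<in> box r. \<exists>q>N. prime q \<and> (\<forall>j\<in>J. int q ^ k dvd t j)})
      \<le> 1 + (\<Sum>q\<in>Q. real (card (D q)))"
    by (simp flip: of_nat_sum of_nat_Suc)
  also have "(\<Sum>q\<in>Q. real (card (D q))) \<le> (\<Sum>q\<in>Q. (3 * K * r) ^ card J * (1 / real q ^ 2))"
    by (intro sum_mono D)
  also have "\<dots> \<le> (\<Sum>q\<in>{N<..m}. (3 * K * r) ^ card J * (1 / real q ^ 2))"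
    using Kr by (intro sum_mono2) (auto simp: Q_def)
  also have "\<dots> = (3 * K * r) ^ card J * (\<Sum>q\<in>{N<..m}. 1 / real q ^ 2)"
    by (simp add: sum_distrib_left)
  also have "\<dots> \<le> (3 * K * r) ^ card J * (1 / real N)"
    using Kr by (intro mult_left_mono sum_inverse_squares_le N) auto
  finally show ?thesis by simp
qed

text \<open>Divides \<open>tail_le\<close> by the lower bound for the box. What matters is that the
  constant is chosen before \<open>N\<close>; only the threshold for \<open>r\<close> depends on
  \<open>N\<close>.\<close>

lemma eventually_tail_density_le:
  assumes kd: "2 \<le> k * card J"
  shows "\<exists>A>0. \<forall>N>0. \<forall>\<^sub>F r in at_top.
    real (card {t \<in> box r. \<exists>q>N. prime q \<and> (\<forall>j\<in>J. int q ^ k dvd t j)}) / real (card (box r)) \<le> A / real N"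
proof (intro exI conjI allI impI)
  define A where "A = (3 * K * coeff_sum) ^ card J"
  have C1: "real_of_int coeff_sum \<ge> 1" using coeff_sum_ge_1 by simp
  show "A + 1 > 0" unfolding A_def using C1 K_ge_1 by (intro add_nonneg_pos) auto
  have d: "card J \<ge> 1" using kd by (cases "card J") auto
  fix N :: nat assume N: "N > 0"
  show "\<forall>\<^sub>F r in at_top. real (card {t \<in> box r. \<exists>q>N. prime q \<and> (\<forall>j\<in>J. int q ^ k dvd t j)})
      / real (card (box r)) \<le> (A + 1) / real N"
    \<comment> \<open>From this threshold on the box has at least \<open>N\<close> points, so the
      zero point costs at most \<open>1 / N\<close>; this is the 1 in the witness
      \<open>A + 1\<close>.\<close>
    using eventually_ge_at_top[of "real_of_int coeff_sum * real N"]
  proof eventually_elim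
    case (elim r)
    have CN: "real_of_int coeff_sum \<le> real_of_int coeff_sum * real N" using C1 N by simp
    then have r: "r \<ge> coeff_sum" "r \<ge> 1" using elim C1 by linarith+
    let ?B = "real (card (box r))"
    have B: "(r / coeff_sum) ^ card J \<le> ?B" by (rule card_box_ge[OF r(1)])
    have "real N \<le> r / coeff_sum" using elim C1 by (simp add: field_simps)
    also have "r / coeff_sum \<le> (r / coeff_sum) ^ card J"
      using r C1 d power_increasing[of 1 "card J" "r / coeff_sum"] by simp
    finally have NB: "real N \<le> ?B" using B by linarith
    have "real (card {t \<in> box r. \<exists>q>N. prime q \<and> (\<forall>j\<in>J. int q ^ k dvd t j)})
        \<le> 1 + (3 * K * r) ^ card J / real N"
      by (rule tail_le[OF kd N r(2)])
    also have "3 * K * r = 3 * K * coeff_sum * (r / coeff_sum)" using C1 by simp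
    also have "\<dots> ^ card J = A * (r / coeff_sum) ^ card J" unfolding A_def by (rule power_mult_distrib)
    also have "1 + A * (r / coeff_sum) ^ card J / real N \<le> ?B / real N + A * ?B / real N"
    proof (intro add_mono divide_right_mono mult_left_mono B)
      show "1 \<le> ?B / real N" using NB N by simp
    qed (use C1 K_ge_1 in \<open>auto simp: A_def\<close>)
    also have "\<dots> = (A + 1) / real N * ?B" by (simp add: add_divide_distrib algebra_simps)
    finally show ?case using NB N by (simp add: divide_le_eq)
  qed
qed

text \<open>The partial products decrease to some \<open>L\<close>, and sieving by the primes up to
  \<open>N\<close> bounds the density from above by \<open>P N\<close>. The assumption on
  \<open>S\<close> fits the primes with \<open>q ^ k\<close> dividing \<open>g\<close>: finitely
  many if \<open>g\<close> is nonzero, all of them otherwise.\<close>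

theorem power_free_density:
  assumes k: "k \<ge> 1" and S: "finite {q \<in> S. prime q} \<or> (\<forall>q. prime q \<longrightarrow> q \<in> S)"
  shows "\<exists>L. (\<lambda>N. \<Prod>q\<in>{q \<in> S. prime q \<and> q \<le> N}. 1 - 1 / real q ^ (k * card J)) \<longlonglongrightarrow> L \<and>
    ((\<lambda>r. real (card {t \<in> box r. \<not> (\<exists>q\<in>S. prime q \<and> (\<forall>j\<in>J. int q ^ k dvd t j))})
      / real (card (box r))) \<longlongrightarrow> L) at_top"
proof -
  define F where "F N = {q \<in> S. prime q \<and> q \<le> N}" for N :: nat
  define P where "P N = (\<Prod>q\<in>F N. 1 - 1 / real q ^ (k * card J))" for N
  define free where "free r = {t \<in> box r. \<not> (\<exists>q\<in>S. prime q \<and> (\<forall>j\<in>J. int q ^ k dvd t j))}" for r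
  define part where "part N r = {t \<in> box r. \<forall>q\<in>F N. \<not> (\<forall>j\<in>J. int q ^ k dvd t j)}" for N r
  define \<rho> where "\<rho> r = real (card (free r)) / real (card (box r))" for r
  define \<sigma> where "\<sigma> N r = real (card (part N r)) / real (card (box r))" for N r
  have finF: "finite (F N)" for N unfolding F_def by simp
  have fin: "finite (free r)" "finite (part N r)" for N r
    unfolding free_def part_def using finite_box by auto
  have factor: "0 \<le> 1 - 1 / real q ^ (k * card J)" "1 - 1 / real q ^ (k * card J) \<le> 1" if "q \<in> F N" for q N
  proof -
    have "real q \<ge> 1" using that prime_gt_0_nat[of q] by (simp add: F_def)
    then have "real q ^ (k * card J) \<ge> 1" by (rule one_le_power)
    then show "0 \<le> 1 - 1 / real q ^ (k * card J)" "1 - 1 / real q ^ (k * card J) \<le> 1"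
      by (auto simp: divide_le_eq)
  qed
  have P_nonneg: "0 \<le> P N" for N unfolding P_def by (intro prod_nonneg factor)
  have "decseq P"
  proof (rule decseq_SucI)
    fix N
    have "P (Suc N) = P N * (\<Prod>q\<in>F (Suc N) - F N. 1 - 1 / real q ^ (k * card J))"
      unfolding P_def using finF by (subst prod.subset_diff[of "F N"]) (auto simp: F_def)
    also have "\<dots> \<le> P N * 1"
      using factor[of _ "Suc N"] P_nonneg by (intro mult_left_mono prod_le_1) auto
    finally show "P (Suc N) \<le> P N" by simp
  qed
  then obtain L where L: "P \<longlonglongrightarrow> L" "\<And>N. L \<le> P N"
    using decseq_convergent[of P 0] P_nonneg by blast
  have \<sigma>: "((\<sigma> N) \<longlongrightarrow> P N) at_top" for N
  proof -
    have eq: "part N r = {t \<in> box r. (\<forall>j\<in>J. int 1 dvd t j) \<and> (\<forall>q\<in>F N. \<not> (\<forall>j\<in>J. int q ^ k dvd t j))}" for r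
      by (simp add: part_def)
    have "((\<lambda>r. real (card (part N r)) / real (card (box r))) \<longlongrightarrow> 1 / real 1 ^ card J * P N) at_top"
      unfolding eq P_def by (rule sieve_density) (auto simp: F_def)
    then show ?thesis by (simp add: \<sigma>_def[abs_def])
  qed
  have "free r \<subseteq> part N r" for N r unfolding free_def part_def F_def by blast
  then have \<rho>_le: "\<rho> r \<le> \<sigma> N r" for N r
    unfolding \<rho>_def \<sigma>_def by (intro divide_right_mono) (auto intro: card_mono fin)
  have L_0: "L = 0" if all: "\<forall>q. prime q \<longrightarrow> q \<in> S" and kd: "k * card J < 2"
  proof (cases "card J = 0")
    case True
    \<comment> \<open>In dimension 0 the exponent is 0 and every factor is \<open>1 - 1\<close>; the
      prime 2 already makes the product vanish.\<close>
    have "P N = 0" if "N \<ge> 2" for N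
    proof -
      have "2 \<in> F N" using all that by (simp add: F_def)
      then show ?thesis unfolding P_def using finF True by (intro prod_zero) (auto intro!: bexI[of _ 2])
    qed
    then have "P \<longlonglongrightarrow> 0" by (intro tendsto_eventually eventually_sequentiallyI[of 2])
    with L(1) show ?thesis by (rule LIMSEQ_unique)
  next
    case False
    have "k * card J = 1"
    proof -
      have "k * card J \<ge> 1" using k False by simp
      with kd show ?thesis by linarith
    qed
    moreover have "F N = {q. prime q \<and> q \<le> N}" for N using all by (auto simp: F_def)
    ultimately have "P = (\<lambda>N. \<Prod>q | prime q \<and> q \<le> N. 1 - 1 / real q)"
      by (simp add: P_def fun_eq_iff)
    then show ?thesis using L(1) prime_product_tendsto_0 LIMSEQ_unique by blast
  qed
  have "(\<rho> \<longlongrightarrow> L) at_top"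
  proof (rule order_tendstoI)
    fix y assume "L < y"
    then obtain N where "P N < y"
      using order_tendstoD(2)[OF L(1)] eventually_sequentially by (metis order_refl)
    then have "\<forall>\<^sub>F r in at_top. \<sigma> N r < y" by (rule order_tendstoD(2)[OF \<sigma>])
    then show "\<forall>\<^sub>F r in at_top. \<rho> r < y"
      by eventually_elim (use \<rho>_le order_le_less_trans in blast)
  next
    fix y assume y: "y < L"
    \<comment> \<open>Lower bound: for finitely many primes the sieve is exact from some
      \<open>N\<close> on; for exponent at least 2 the tail is small; for \<open>L = 0\<close>
      nonnegativity suffices.\<close>
    consider "finite {q \<in> S. prime q}" | "2 \<le> k * card J" | "L = 0" using S L_0 by (metis not_less)
    then show "\<forall>\<^sub>F r in at_top. y < \<rho> r"
    proof cases
      case 1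
      then obtain N where "\<forall>q\<in>{q \<in> S. prime q}. q \<le> N"
        using finite_nat_set_iff_bounded_le by blast
      then have "\<rho> r = \<sigma> N r" for r
        unfolding \<rho>_def \<sigma>_def free_def part_def F_def by (metis (lifting) mem_Collect_eq)
      moreover have "y < P N" using y L(2) by (rule less_le_trans)
      ultimately show ?thesis using order_tendstoD(1)[OF \<sigma>] by simp
    next
      case 2
      then obtain A where A: "A > 0" "\<And>N. N > 0 \<Longrightarrow> \<forall>\<^sub>F r in at_top.
          real (card {t \<in> box r. \<exists>q>N. prime q \<and> (\<forall>j\<in>J. int q ^ k dvd t j)}) / real (card (box r)) \<le> A / real N"
        using eventually_tail_density_le by blast
      \<comment> \<open>Chosen so that the tail \<open>A / N\<close> is smaller than the gap
        \<open>L - y\<close>.\<close>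
      obtain N :: nat where N: "N > A / (L - y)" using reals_Archimedean2 by blast
      have "A / (L - y) > 0" using A y by simp
      then have N0: "N > 0" using N by (metis less_trans of_nat_0_less_iff)
      have "A / real N < L - y" using N N0 y by (simp add: field_simps)
      then have "y + A / real N < P N" using L(2)[of N] by linarith
      from order_tendstoD(1)[OF \<sigma> this] A(2)[OF N0] show ?thesis
      proof eventually_elim
        case (elim r)
        let ?T = "{t \<in> box r. \<exists>q>N. prime q \<and> (\<forall>j\<in>J. int q ^ k dvd t j)}"
        have "part N r \<subseteq> free r \<union> ?T"
        proof
          fix t assume t: "t \<in> part N r"
          show "t \<in> free r \<union> ?T"
          proof (cases "\<exists>q\<in>S. prime q \<and> (\<forall>j\<in>J. int q ^ k dvd t j)")
            case True
            then obtain q where q: "q \<in> S" "prime q" "\<forall>j\<in>J. int q ^ k dvd t j" by blast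
            then have "q \<notin> F N" using t by (auto simp: part_def)
            then have "q > N" using q by (simp add: F_def)
            then show ?thesis using q t by (auto simp: part_def)
          next
            case False
            then show ?thesis using t by (simp add: free_def part_def)
          qed
        qed
        then have "card (part N r) \<le> card (free r \<union> ?T)"
          using fin finite_box by (intro card_mono) auto
        also have "\<dots> \<le> card (free r) + card ?T" by (rule card_Un_le)
        finally have "\<sigma> N r \<le> \<rho> r + real (card ?T) / real (card (box r))"
          unfolding \<sigma>_def \<rho>_def add_divide_distrib[symmetric]
          by (intro divide_right_mono) auto
        with elim show ?case by linarith
      qed
    next
      case 3
      have "0 \<le> \<rho> r" for r by (simp add: \<rho>_def)
      with 3 y show ?thesis by (intro always_eventually allI) (metis less_le_trans)
    qed
  qed
  with L(1) show ?thesis unfolding P_def F_def \<rho>_def free_def by blast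
qed

end

section \<open>Reduction by the Smith normal form\<close>

text \<open>Each summand is an outer product, of rank at most 1, and rank is subadditive.\<close>

lemma (in vec_space) rank_le_sum_products:
  fixes f g :: "nat \<Rightarrow> nat \<Rightarrow> 'a"
  assumes "A \<in> carrier_mat n nc"
    and "\<And>a b. a < n \<Longrightarrow> b < nc \<Longrightarrow> A $$ (a, b) = (\<Sum>l<k. f l a * g l b)"
  shows "rank A \<le> k"
  using assms
proof (induction k arbitrary: A)
  case 0
  then have "A = 0\<^sub>m n nc" by (intro eq_matI) auto
  then show ?case by (simp add: rank_0I)
next
  case (Suc k)
  define A1 where "A1 = mat n nc (\<lambda>(a, b). \<Sum>l<k. f l a * g l b)"
  define A2 where "A2 = mat n nc (\<lambda>(a, b). f k a * g k b)"
  have carrier: "A1 \<in> carrier_mat n nc" "A2 \<in> carrier_mat n nc" by (simp_all add: A1_def A2_def)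
  have "A = A1 + A2"
    using Suc.prems by (intro eq_matI) (auto simp: A1_def A2_def)
  then have "rank A \<le> rank A1 + rank A2" using rank_subadditive[OF carrier] by simp
  moreover have "rank A1 \<le> k" using carrier by (intro Suc.IH) (auto simp: A1_def)
  moreover have "rank A2 \<le> 1"
    by (rule rank_le_1_product_entries[OF carrier(2)]) (auto simp: A2_def)
  ultimately show ?case by simp
qed

text \<open>Applied to both \<open>V\<close> and \<open>W\<close>, this shows that a vector and its
  image have the same common divisors.\<close>

lemma dvd_mult_mat_vec:
  fixes v :: "int vec"
  assumes "\<And>j. j < dim_vec v \<Longrightarrow> d dvd v $ j" and "i < dim_row B" and "dim_col B = dim_vec v"
  shows "d dvd (B *\<^sub>v v) $ i"
  using assms by (auto simp: scalar_prod_def intro!: dvd_sum)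

lemma diag_mult_mat_vec_index:
  fixes D :: "int mat"
  assumes D: "D \<in> carrier_mat s n" and diag: "\<And>i j. i < s \<Longrightarrow> j < n \<Longrightarrow> i \<noteq> j \<Longrightarrow> D $$ (i, j) = 0"
    and v: "v \<in> carrier_vec n" and i: "i < s"
  shows "(D *\<^sub>v v) $ i = (if i < n then D $$ (i, i) * v $ i else 0)"
proof -
  have "(D *\<^sub>v v) $ i = (\<Sum>j\<in>{0..<n}. D $$ (i, j) * v $ j)"
    using D v i by (simp add: scalar_prod_def)
  also have "\<dots> = (\<Sum>j\<in>{0..<n}. if j = i then D $$ (i, i) * v $ i else 0)"
    using diag[OF i] by (intro sum.cong) auto
  finally show ?thesis by simp
qed

text \<open>Expanding \<open>U' * (D * W)\<close> along the diagonal writes \<open>A\<close> as a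
  sum of outer products of columns of \<open>U'\<close> with rows of \<open>W\<close>, and only the
  first \<open>i\<close> diagonal entries contribute.\<close>

lemma int_rank_le:
  assumes A: "A \<in> carrier_mat s n" and U': "U' \<in> carrier_mat s s" and W: "W \<in> carrier_mat n n"
    and D: "D \<in> carrier_mat s n" and eq: "A = U' * (D * W)"
    and diag: "\<And>i j. i < s \<Longrightarrow> j < n \<Longrightarrow> i \<noteq> j \<Longrightarrow> D $$ (i, j) = 0"
    and i: "i \<le> min s n" and zero: "\<And>l. i \<le> l \<Longrightarrow> l < min s n \<Longrightarrow> D $$ (l, l) = 0"
  shows "int_rank A \<le> i"
proof -
  interpret vec_space "TYPE(real)" s .
  have "A $$ (a, b) = (\<Sum>l<i. (U' $$ (a, l) * D $$ (l, l)) * W $$ (l, b))" if ab: "a < s" "b < n" for a b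
  proof -
    have DW: "(D * W) $$ (l, b) = (if l < n then D $$ (l, l) * W $$ (l, b) else 0)" if "l < s" for l
    proof -
      have "(D * W) $$ (l, b) = (D *\<^sub>v col W b) $ l" using D W that ab by simp
      also have "\<dots> = (if l < n then D $$ (l, l) * col W b $ l else 0)"
        using W by (intro diag_mult_mat_vec_index[OF D diag _ that]) auto
      finally show ?thesis using W ab by simp
    qed
    have UE: "(U' * E) $$ (a, b) = (\<Sum>l\<in>{0..<s}. U' $$ (a, l) * E $$ (l, b))"
      if "E \<in> carrier_mat s n" for E
      using that U' ab by (simp add: scalar_prod_def)
    have "A $$ (a, b) = (\<Sum>l\<in>{0..<s}. U' $$ (a, l) * (D * W) $$ (l, b))"
      unfolding eq by (rule UE) (use D W in simp)
    also have "\<dots> = (\<Sum>l\<in>{..<i}. U' $$ (a, l) * (D * W) $$ (l, b))"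
    proof (rule sum.mono_neutral_right)
      show "\<forall>l\<in>{0..<s} - {..<i}. U' $$ (a, l) * (D * W) $$ (l, b) = 0"
        using zero by (auto simp: DW)
    qed (use i in auto)
    also have "\<dots> = (\<Sum>l<i. (U' $$ (a, l) * D $$ (l, l)) * W $$ (l, b))"
      using i by (intro sum.cong) (auto simp: DW)
    finally show ?thesis .
  qed
  then have "rank (real_mat A) \<le> i"
    using A by (intro rank_le_sum_products[where nc = n
      and f = "\<lambda>l a. real_of_int (U' $$ (a, l) * D $$ (l, l))" and g = "\<lambda>l b. real_of_int (W $$ (l, b))"]) auto
  then show ?thesis using A by (simp add: int_rank_def)
qed

text \<open>By the divisibility chain a zero at position \<open>i\<close> forces zeros at all later
  positions, and then \<open>int_rank_le\<close> gives rank at most \<open>i\<close>.\<close>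

lemma smith_diag_nonzero:
  assumes A: "A \<in> carrier_mat s n" and U': "U' \<in> carrier_mat s s" and W: "W \<in> carrier_mat n n"
    and eq: "A = U' * (D * W)" and snf: "is_smith_normal_form A D" and i: "i < int_rank A"
  shows "i < min s n" and "D $$ (i, i) \<noteq> 0"
proof -
  have D: "D \<in> carrier_mat s n" and diag: "\<And>i j. i < s \<Longrightarrow> j < n \<Longrightarrow> i \<noteq> j \<Longrightarrow> D $$ (i, j) = 0"
    and dvd: "\<And>i. Suc i < min s n \<Longrightarrow> D $$ (i, i) dvd D $$ (Suc i, Suc i)"
    using snf A by (auto simp: is_smith_normal_form_def)
  have "int_rank A \<le> min s n"
    by (rule int_rank_le[OF A U' W D eq diag]) auto
  with i show im: "i < min s n" by simp
  show "D $$ (i, i) \<noteq> 0"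
  proof
    assume 0: "D $$ (i, i) = 0"
    have "D $$ (l, l) = 0" if "i \<le> l" "l < min s n" for l
      using that
    proof (induction l rule: dec_induct)
      case (step l)
      then show ?case using dvd[of l] by auto
    qed (rule 0)
    then have "int_rank A \<le> i"
      using im by (intro int_rank_le[OF A U' W D eq diag]) auto
    with i show False by simp
  qed
qed

section \<open>Transfer of the count to the affine subspace\<close>

lemma real_mat_mult_vec_eq_iff:
  assumes "A \<in> carrier_mat s n" and "x \<in> carrier_vec n" and "y \<in> carrier_vec n"
  shows "real_mat A *\<^sub>v real_vec x = real_mat A *\<^sub>v real_vec y \<longleftrightarrow> A *\<^sub>v x = A *\<^sub>v y"
proof -
  have "real_mat A *\<^sub>v real_vec z = real_vec (A *\<^sub>v z)" if "z \<in> carrier_vec n" for z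
    using of_int_hom.mult_mat_vec_hom[OF assms(1) that, where 'a = real] by simp
  then show ?thesis using assms of_int_hom.vec_hom_inj[where 'a = real] by auto
qed

theorem theorem4p2:
  fixes k s n m :: nat
    and A U V W D :: "int mat"
    and p p' :: "int Matrix.vec"
    and H :: "real Matrix.vec set"
    and g :: int
  assumes "k \<ge> 1"
    and "A \<in> carrier_mat s n"
    and "Gcd (elements_mat A) = 1"
    and "p \<in> carrier_vec n"
    and "H = {x \<in> carrier_vec n. real_mat A *\<^sub>v x = real_mat A *\<^sub>v real_vec p}"
    and "U \<in> carrier_mat s s" and "invertible_mat U"
    and "V \<in> carrier_mat n n" and "invertible_mat V"
    and "W \<in> carrier_mat n n" and "inverts_mat V W" and "inverts_mat W V"
    and "U * A * V = D"
    and "is_smith_normal_form A D"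
    and "m = int_rank A"
    and "p' = W *\<^sub>v p"
    and "g = Gcd ((\<lambda>i. p' $ i) ` {..<m})"
  shows "\<exists>L. has_prime_product {q. int q ^ k dvd g} (\<lambda>q. 1 - 1 / real q ^ (k * (n - m))) L
           \<and> has_k_free_density k n H L"
proof -
  note k = assms(1) and A = assms(2) and p = assms(4) and U = assms(6) and V = assms(8) and W = assms(10)
  have VW: "V * W = 1\<^sub>m n" and WV: "W * V = 1\<^sub>m n"
    using assms(11,12) V W by (auto simp: inverts_mat_def)
  obtain U' where "inverts_mat U U'" "inverts_mat U' U"
    using assms(7) by (auto simp: invertible_mat_def)
  \<comment> \<open>\<open>invertible_mat\<close> does not fix the dimensions of the inverse; they
    are read off from the two product equations.\<close>
  then have U'U: "U' * U = 1\<^sub>m s" and U': "U' \<in> carrier_mat s s"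
    using U unfolding inverts_mat_def
    by (metis carrier_matD(1,2) index_mult_mat(2,3) index_one_mat(2,3) carrier_matI)+
  have D: "D \<in> carrier_mat s n" and diag: "\<And>i j. i < s \<Longrightarrow> j < n \<Longrightarrow> i \<noteq> j \<Longrightarrow> D $$ (i, j) = 0"
    and D_0: "\<And>i. i < min s n \<Longrightarrow> m \<le> i \<Longrightarrow> D $$ (i, i) = 0"
    using assms(14,15) A by (auto simp: is_smith_normal_form_def)
  have DW: "D * W = U * A"
  proof -
    have "D * W = U * A * (V * W)"
      unfolding assms(13)[symmetric] using U A V W by (intro assoc_mult_mat) auto
    then show ?thesis using U A by (simp add: VW)
  qed
  have A_eq: "A = U' * (D * W)"
  proof -
    have "U' * (D * W) = U' * U * A" unfolding DW using U' U A by (simp add: assoc_mult_mat)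
    then show ?thesis using A by (simp add: U'U)
  qed
  have m_less: "i < s" "i < n" and D_nz: "D $$ (i, i) \<noteq> 0" if "i < m" for i
    using smith_diag_nonzero[OF A U' W A_eq assms(14)] that assms(15) by auto
  have mn: "m \<le> n" using m_less(2) by (meson leI less_irrefl)
  have p': "p' \<in> carrier_vec n" using W p assms(16) by simp
  have WVv: "W *\<^sub>v (V *\<^sub>v y) = y" if "y \<in> carrier_vec n" for y
    using that W V WV by (simp flip: assoc_mult_mat_vec)
  have VWv: "V *\<^sub>v (W *\<^sub>v y) = y" if "y \<in> carrier_vec n" for y
    using that W V VW by (simp flip: assoc_mult_mat_vec)
  \<comment> \<open>Multiplication by the invertible \<open>U\<close> turns the equation into
    \<open>D (W x) = D p'\<close>. Nonzero diagonal entries cancel in the first \<open>m\<close>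
    rows, and all further rows of \<open>D\<close> vanish.\<close>
  have slice: "A *\<^sub>v x = A *\<^sub>v p \<longleftrightarrow> (\<forall>i<m. (W *\<^sub>v x) $ i = p' $ i)" if x: "x \<in> carrier_vec n" for x
  proof -
    have Wx: "W *\<^sub>v x \<in> carrier_vec n" using W x by simp
    have UA: "U *\<^sub>v (A *\<^sub>v z) = D *\<^sub>v (W *\<^sub>v z)" if "z \<in> carrier_vec n" for z
      using that U A D W DW by (simp flip: assoc_mult_mat_vec)
    have U'v: "U' *\<^sub>v (U *\<^sub>v z) = z" if "z \<in> carrier_vec s" for z
      using that U U' U'U by (simp flip: assoc_mult_mat_vec)
    have "A *\<^sub>v x = A *\<^sub>v p \<longleftrightarrow> U *\<^sub>v (A *\<^sub>v x) = U *\<^sub>v (A *\<^sub>v p)"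
      using U'v A x p by (metis mult_mat_vec_carrier)
    also have "\<dots> \<longleftrightarrow> D *\<^sub>v (W *\<^sub>v x) = D *\<^sub>v p'" using UA x p by (simp add: assms(16))
    also have "\<dots> \<longleftrightarrow> (\<forall>i<s. (D *\<^sub>v (W *\<^sub>v x)) $ i = (D *\<^sub>v p') $ i)"
      unfolding vec_eq_iff using D by (simp del: index_mult_mat_vec)
    also have "\<dots> \<longleftrightarrow> (\<forall>i<m. (W *\<^sub>v x) $ i = p' $ i)"
    proof -
      have "(D *\<^sub>v (W *\<^sub>v x)) $ i = (D *\<^sub>v p') $ i \<longleftrightarrow> (i < m \<longrightarrow> (W *\<^sub>v x) $ i = p' $ i)"
        if i: "i < s" for i
      proof -
        have index: "(D *\<^sub>v v) $ i = (if i < n then D $$ (i, i) * v $ i else 0)" if "v \<in> carrier_vec n" for v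
          using that i by (intro diag_mult_mat_vec_index[OF D]) (auto simp: diag)
        show ?thesis
          unfolding index[OF Wx] index[OF p']
          using D_nz[of i] D_0[of i] m_less[of i] i by (cases "i < m") auto
      qed
      then show ?thesis using m_less(1) by blast
    qed
    finally show ?thesis .
  qed
  \<comment> \<open>The free parameters keep their original indices \<open>m..<n\<close>, so no
    shift of indices occurs; \<open>b\<close> collects the contribution of the fixed
    coordinates.\<close>
  define J where "J = {m..<n}"
  define y where "y t = Matrix.vec n (\<lambda>i. if i < m then p' $ i else t i)" for t :: "nat \<Rightarrow> int"
  define x where "x t = V *\<^sub>v y t" for t
  define b where "b i = (\<Sum>j<m. V $$ (i, j) * p' $ j)" for i
  \<comment> \<open>The parameters are recovered as coordinates of \<open>W x\<close>, so the
    entries of \<open>W\<close> bound the left inverse; the 1 ensures that \<open>K\<close> is at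
    least 1.\<close>
  define K where "K = 1 + (\<Sum>j<n. \<Sum>i<n. \<bar>real_of_int (W $$ (j, i))\<bar>)"
  have y: "y t \<in> carrier_vec n" for t by (simp add: y_def)
  have x: "x t \<in> carrier_vec n" for t using V y by (simp add: x_def)
  have Wx: "W *\<^sub>v x t = y t" for t unfolding x_def by (rule WVv[OF y])
  have x_index: "x t $ i = b i + (\<Sum>j\<in>J. V $$ (i, j) * t j)" if "i < n" for t i
  proof -
    have "x t $ i = (\<Sum>j\<in>{0..<n}. V $$ (i, j) * y t $ j)"
      using V y[of t] that by (simp add: x_def scalar_prod_def)
    also have "\<dots> = (\<Sum>j\<in>{0..<m}. V $$ (i, j) * y t $ j) + (\<Sum>j\<in>{m..<n}. V $$ (i, j) * y t $ j)"
      using mn by (simp add: sum.atLeastLessThan_concat)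
    also have "(\<Sum>j\<in>{0..<m}. V $$ (i, j) * y t $ j) = b i"
      unfolding b_def using mn by (intro sum.cong) (auto simp: y_def)
    also have "(\<Sum>j\<in>{m..<n}. V $$ (i, j) * y t $ j) = (\<Sum>j\<in>J. V $$ (i, j) * t j)"
      unfolding J_def by (intro sum.cong) (auto simp: y_def)
    finally show ?thesis .
  qed
  interpret lattice_slice "{..<n}" J "\<lambda>i j. V $$ (i, j)" b K
  proof
    show "1 \<le> K" unfolding K_def by (simp add: sum_nonneg)
    fix t :: "nat \<Rightarrow> int" and r :: real and j
    assume bound: "\<And>i. i \<in> {..<n} \<Longrightarrow> \<bar>real_of_int (b i + (\<Sum>j\<in>J. V $$ (i, j) * t j))\<bar> \<le> r" and j: "j \<in> J"
    have jn: "j < n" "\<not> j < m" using j by (auto simp: J_def)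
    \<comment> \<open>An element of \<open>J\<close> is also a coordinate index below
      \<open>n\<close>, so the bound is available at \<open>j\<close> itself.\<close>
    have r: "r \<ge> 0" using bound[of j] jn by (meson abs_ge_zero lessThan_iff order_trans)
    have "t j = (W *\<^sub>v x t) $ j" unfolding Wx using jn by (simp add: y_def)
    also have "\<dots> = (\<Sum>i\<in>{..<n}. W $$ (j, i) * x t $ i)"
      using W x[of t] jn by (simp add: scalar_prod_def atLeast0LessThan)
    finally have "\<bar>real_of_int (t j)\<bar> \<le> (\<Sum>i<n. \<bar>real_of_int (W $$ (j, i))\<bar> * \<bar>real_of_int (x t $ i)\<bar>)"
      by (simp add: order_trans[OF sum_abs] flip: abs_mult)
    also have "\<dots> \<le> (\<Sum>i<n. \<bar>real_of_int (W $$ (j, i))\<bar> * r)"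
      using bound by (intro sum_mono mult_left_mono) (auto simp: x_index)
    also have "\<dots> = (\<Sum>i<n. \<bar>real_of_int (W $$ (j, i))\<bar>) * r" by (simp add: sum_distrib_right)
    also have "\<dots> \<le> K * r"
    proof (rule mult_right_mono[OF _ r])
      show "(\<Sum>i<n. \<bar>real_of_int (W $$ (j, i))\<bar>) \<le> K"
        unfolding K_def using jn member_le_sum[of j "{..<n}" "\<lambda>j. \<Sum>i<n. \<bar>real_of_int (W $$ (j, i))\<bar>"]
        by (simp add: sum_nonneg)
    qed
    finally show "\<bar>real_of_int (t j)\<bar> \<le> K * r" .
  qed (auto simp: J_def)
  have form: "form t i = x t $ i" if "i < n" for t i
    using x_index[OF that] by (simp add: form_def)
  have bij: "bij_betw x (box r) (lattice_points n H r)" for r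
  \<comment> \<open>Restricting \<open>W z\<close> to \<open>J\<close> makes the inverse
    extensional, as \<open>box\<close> demands.\<close>
  proof (rule bij_betwI[where g = "\<lambda>z. \<lambda>j\<in>J. (W *\<^sub>v z) $ j"])
    have H: "real_vec z \<in> H \<longleftrightarrow> (\<forall>i<m. (W *\<^sub>v z) $ i = p' $ i)" if z: "z \<in> carrier_vec n" for z
      using slice[OF z] real_mat_mult_vec_eq_iff[OF A z p] z by (simp add: assms(5))
    show "x \<in> box r \<rightarrow> lattice_points n H r"
    proof
      fix t assume "t \<in> box r"
      then have "\<bar>real_of_int (x t $ i)\<bar> \<le> r" if "i < n" for i
        using that form by (auto simp: box_def)
      then have "real_vec (x t) \<in> cube n r"
        using x[of t] by (auto simp: cube_def abs_le_iff minus_le_iff)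
      moreover have "real_vec (x t) \<in> H"
        unfolding H[OF x] Wx using mn by (simp add: y_def)
      ultimately show "x t \<in> lattice_points n H r" using x by (simp add: lattice_points_def)
    qed
    have inv: "x (\<lambda>j\<in>J. (W *\<^sub>v z) $ j) = z" if "z \<in> lattice_points n H r" for z
    proof -
      have z: "z \<in> carrier_vec n" "real_vec z \<in> H" using that by (auto simp: lattice_points_def)
      have "y (\<lambda>j\<in>J. (W *\<^sub>v z) $ j) = W *\<^sub>v z"
        using z H W by (intro eq_vecI) (auto simp: y_def J_def)
      then show ?thesis using VWv z by (simp add: x_def)
    qed
    show "x (\<lambda>j\<in>J. (W *\<^sub>v z) $ j) = z" if "z \<in> lattice_points n H r" for z using inv[OF that] .
    show "(\<lambda>z. \<lambda>j\<in>J. (W *\<^sub>v z) $ j) \<in> lattice_points n H r \<rightarrow> box r"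
    proof
      fix z assume z: "z \<in> lattice_points n H r"
      then have "\<bar>real_of_int (z $ i)\<bar> \<le> r" if "i < n" for i
        using that by (auto simp: lattice_points_def cube_def abs_le_iff minus_le_iff)
      then show "(\<lambda>j\<in>J. (W *\<^sub>v z) $ j) \<in> box r"
        using form inv[OF z] by (auto simp: box_def)
    qed
    show "(\<lambda>j\<in>J. (W *\<^sub>v x t) $ j) = t" if "t \<in> box r" for t
    proof (rule extensionalityI[of _ J])
      show "t \<in> extensional J" using that by (auto simp: box_def PiE_def)
    qed (auto simp: Wx y_def J_def)
  qed
  let ?S = "{q. int q ^ k dvd g}"
  let ?free = "\<lambda>t. \<not> (\<exists>q\<in>?S. prime q \<and> (\<forall>j\<in>J. int q ^ k dvd t j))"
  \<comment> \<open>\<open>V\<close> and \<open>W\<close> are integral and mutually inverse, so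
    \<open>x t\<close> and \<open>y t\<close> have the same common divisors, and those of
    \<open>y t\<close> are the common divisors of \<open>g\<close> and the parameters.\<close>
  have free: "k_free k (x t) \<longleftrightarrow> ?free t" for t
  proof -
    have "d dvd Gcd ((\<lambda>i. x t $ i) ` {..<dim_vec (x t)}) \<longleftrightarrow> d dvd g \<and> (\<forall>j\<in>J. d dvd t j)" for d :: int
    proof -
      have "d dvd Gcd ((\<lambda>i. x t $ i) ` {..<dim_vec (x t)}) \<longleftrightarrow> (\<forall>i<n. d dvd x t $ i)"
        using x[of t] by (auto simp: dvd_Gcd_iff)
      also have "\<dots> \<longleftrightarrow> (\<forall>i<n. d dvd y t $ i)"
      proof
        assume "\<forall>i<n. d dvd x t $ i"
        then show "\<forall>i<n. d dvd y t $ i"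
          unfolding Wx[symmetric] using W x[of t] by (auto intro!: dvd_mult_mat_vec simp del: index_mult_mat_vec)
      next
        assume "\<forall>i<n. d dvd y t $ i"
        then show "\<forall>i<n. d dvd x t $ i"
          unfolding x_def using V y[of t] by (auto intro!: dvd_mult_mat_vec simp del: index_mult_mat_vec)
      qed
      also have "\<dots> \<longleftrightarrow> (\<forall>i<m. d dvd p' $ i) \<and> (\<forall>j\<in>J. d dvd t j)"
        using mn by (auto simp: y_def J_def)
      also have "(\<forall>i<m. d dvd p' $ i) \<longleftrightarrow> d dvd g"
        by (auto simp: assms(17) dvd_Gcd_iff)
      finally show ?thesis .
    qed
    then show ?thesis unfolding k_free_def by blast
  qed
  have card_lattice: "card (lattice_points n H r) = card (box r)" for r
    using bij_betw_same_card[OF bij] by simp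
  have card_free: "card (free_lattice_points k n H r) = card {t \<in> box r. ?free t}" for r
  proof -
    have "free_lattice_points k n H r = x ` {t \<in> box r. ?free t}"
      unfolding free_lattice_points_def free[symmetric] bij_betw_imp_surj_on[OF bij[of r], symmetric]
      by blast
    moreover have "inj_on x {t \<in> box r. ?free t}"
      using bij_betw_imp_inj_on[OF bij[of r]] by (rule inj_on_subset) auto
    ultimately show ?thesis by (simp add: card_image)
  qed
  \<comment> \<open>For nonzero \<open>g\<close> a prime in the set satisfies
    \<open>q <= q ^ k <= |g|\<close>; for \<open>g = 0\<close> the divisibility always
    holds.\<close>
  have "finite {q \<in> ?S. prime q} \<or> (\<forall>q. prime q \<longrightarrow> q \<in> ?S)"
  proof (cases "g = 0")
    case False
    have "q \<le> nat \<bar>g\<bar>" if "q \<in> ?S" "prime q" for q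
    proof -
      have "q \<le> q ^ k" using k prime_gt_0_nat[OF that(2)] by (simp add: self_le_power)
      moreover have "int q ^ k \<le> \<bar>g\<bar>"
        using dvd_imp_le_int[of g "int q ^ k"] that(1) False by simp
      ultimately show ?thesis by (metis le_nat_iff abs_ge_zero of_nat_mono of_nat_power order_trans)
    qed
    then have "{q \<in> ?S. prime q} \<subseteq> {..nat \<bar>g\<bar>}" by blast
    then show ?thesis using finite_subset by blast
  qed simp
  from power_free_density[OF k this] show ?thesis
    unfolding has_prime_product_def has_k_free_density_def card_lattice card_free
    by (simp add: J_def)
qed

end
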